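(* Let $n\ge 2$, $b\in\mathbb{R}^{n^2}$, $\lambda>0$, $\mu_1>0$, $\mu_2>0$, and let $D,P\in\mathbb{R}^{n^2\times n^2}$ and the block soft-thresholding operator $\mathcal{S}$ be as defined in the context. Consider the constrained form of the isotropic total variation denoising problem $$\min_{d_x,d_y,w,u,v}\ \lambda\sum_{i=1}^{n^2}\big\|([d_x]_i,[d_y]_i)\big\|+\tfrac12\|u-b\|^2\quad\text{s.t.}\quad d_x=Du,\ \ d_y=P^TDv,\ \ u=w,\ \ v=Pw, \qquad (\ast)$$ with all variables in $\mathbb{R}^{n^2}$. Starting from arbitrary $u^0,v^0,\gamma_x^0,\gamma_y^0,\gamma_u^0,\gamma_v^0\in\mathbb{R}^{n^2}$, define for $k=0,1,2,\dots$ successively: 1. $(d_x^{k+1},d_y^{k+1})=\mathcal{S}\big((Du^k+\mu_1\gamma_x^k,\ P^TDv^k+\mu_1\gamma_y^k),\ \lambda\mu_1\big)$; 2. $w^{k+1}=\frac12\left(u^k+P^Tv^k+\mu_2(\gamma_u^k+P^T\gamma_v^k)\right)$; 3. $v^{k+1}$ is the unique solution of $\left(D^TD+\frac{\mu_1}{\mu_2}I\right)v=\mu_1\left(\frac1{\mu_2}Pw^{k+1}-\gamma_v^k\right)+D^TP(d_y^{k+1}-\mu_1\gamma_y^k)$; 4. $u^{k+1}$ is the unique solution of $\left(D^TD+\left(\mu_1+\frac{\mu_1}{\mu_2}\right)I\right)u=\mu_1\left(b-\gamma_u^k+\frac1{\mu_2}w^{k+1}\right)+D^T(d_x^{k+1}-\mu_1\gamma_x^k)$;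 5. $\gamma_x^{k+1}=\gamma_x^k+\frac1{\mu_1}(Du^{k+1}-d_x^{k+1})$, $\ \gamma_y^{k+1}=\gamma_y^k+\frac1{\mu_1}(P^TDv^{k+1}-d_y^{k+1})$, $\ \gamma_u^{k+1}=\gamma_u^k+\frac1{\mu_2}(u^{k+1}-w^{k+1})$, $\ \gamma_v^{k+1}=\gamma_v^k+\frac1{\mu_2}(v^{k+1}-Pw^{k+1})$. Then the sequence $\big((d_x^k,d_y^k,w^k,u^k,v^k),(\gamma_x^k,\gamma_y^k,\gamma_u^k,\gamma_v^k)\big)_{k\ge1}$ converges to a primal-dual optimal solution pair of problem $(\ast)$.
   Context: $\|\cdot\|$ is the Euclidean norm. An $n\times n$ image $U=(U_{ij})$ is identified with the column-major vector $u\in\mathbb{R}^{n^2}$, $u_{i+(j-1)n}=U_{ij}$, $1\le i,j\le n$. The matrix $D\in\mathbb{R}^{n^2\times n^2}$ is block diagonal with $n$ identical diagonal $n\times n$ blocks; the first $n-1$ rows of each block have $-1$ on the diagonal and $1$ on the super-diagonal (zeros elsewhere), and the last row of each block is zero (reflective Neumann boundary condition). The matrix $P$ is the $n^2\times n^2$ permutation matrix such that $Pu$ is the row-major vectorization of the image: $(Pu)_{j+(i-1)n}=u_{i+(j-1)n}$. Thus $Du$ and $P^TDPu$ are the two discrete partial derivatives of the image, both in column-major order. For $p,q\in\mathbb{R}^{n^2}$ and $t>0$, the block soft-thresholding operator $\mathcal{S}((p,q),t)\in\mathbb{R}^{n^2}\times\mathbb{R}^{n^2}$ acts on the blocks $x_i=(p_i,q_i)\in\mathbb{R}^2$,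 $i=1,\dots,n^2$, by $\mathcal{S}((p,q),t)_i=\max\{\|x_i\|-t,0\}\,\frac{x_i}{\|x_i\|}$, with value $0$ when $x_i=0$. A primal-dual optimal solution pair of $(\ast)$ is a pair $\big((d_x^*,d_y^*,w^*,u^*,v^* ),(\gamma_x^*,\gamma_y^*,\gamma_u^*,\gamma_v^* )\big)$ such that $(d_x^*,d_y^*,w^*,u^*,v^* )$ is an optimal solution of $(\ast)$ and minimizes over all $(d_x,d_y,w,u,v)$ the Lagrangian $$\lambda\sum_{i}\|([d_x]_i,[d_y]_i)\|+\tfrac12\|u-b\|^2+(\gamma_x^{*})^{T}(Du-d_x)+(\gamma_y^{*})^{T}(P^TDv-d_y)+(\gamma_u^{*})^{T}(u-w)+(\gamma_v^{*})^{T}(v-Pw).$$ *)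

theory Defs
  imports "HOL-Analysis.Analysis"
begin

text \<open>Vectors of length \<open>n\<^sup>2\<close> have type \<open>real ^ 'm\<close> with \<open>CARD('m) = n^2\<close>. The linear order on
  \<open>'m\<close> numbers the coordinates \<open>1, \<dots>, n\<^sup>2\<close>; coordinate number \<open>i + (j - 1) * n\<close> is pixel
  \<open>(i, j)\<close>, so that \<open>i\<close> is its \<open>pix_row\<close> and \<open>j\<close> its \<open>pix_col\<close>.\<close>

definition position :: "'m::{finite,linorder} \<Rightarrow> nat" where
  "position k = card {..k}"

definition pix_row :: "nat \<Rightarrow> 'm::{finite,linorder} \<Rightarrow> nat" where
  "pix_row n k = (position k - 1) mod n + 1"

definition pix_col :: "nat \<Rightarrow> 'm::{finite,linorder} \<Rightarrow> nat" where
  "pix_col n k = (position k - 1) div n + 1"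

text \<open>The diagonal block containing coordinate \<open>k\<close> is number \<open>pix_col n k\<close>, and \<open>pix_row n k\<close> is
  the index of \<open>k\<close> within that block.\<close>

definition diff_matrix :: "nat \<Rightarrow> real ^ 'm::{finite,linorder} ^ 'm::{finite,linorder}" where
  "diff_matrix n = (\<chi> k l.
     if pix_col n k = pix_col n l \<and> pix_row n k < n then
       (if pix_row n l = pix_row n k then - 1
        else if pix_row n l = pix_row n k + 1 then 1 else 0)
     else 0)"

definition row_major_perm :: "nat \<Rightarrow> real ^ 'm::{finite,linorder} ^ 'm::{finite,linorder}" where
  "row_major_perm n = (\<chi> k l.
     if \<exists>i\<in>{1..n}. \<exists>j\<in>{1..n}. position k = j + (i - 1) * n \<and> position l = i + (j - 1) * n
     then 1 else 0)"

text \<open>The norm of \<open>real \<times> real\<close> is the Euclidean one.\<close>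

definition soft_threshold :: "real \<times> real \<Rightarrow> real \<Rightarrow> real \<times> real" where
  "soft_threshold x t = (if x = 0 then 0 else (max (norm x - t) 0 / norm x) *\<^sub>R x)"

definition block_soft_threshold ::
  "(real ^ 'm::finite) \<times> (real ^ 'm::finite) \<Rightarrow> real \<Rightarrow> (real ^ 'm) \<times> (real ^ 'm)" where
  "block_soft_threshold pq t =
     ((\<chi> i. fst (soft_threshold (fst pq $ i, snd pq $ i) t)),
      (\<chi> i. snd (soft_threshold (fst pq $ i, snd pq $ i) t)))"

text \<open>Primal variables are the tuples \<open>(dx, dy, w, u, v)\<close>, multipliers the tuples
  \<open>(gx, gy, gu, gv)\<close>.\<close>

type_synonym 'm primal =
  "(real ^ 'm) \<times> (real ^ 'm) \<times> (real ^ 'm) \<times> (real ^ 'm) \<times> (real ^ 'm)"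

type_synonym 'm dual = "(real ^ 'm) \<times> (real ^ 'm) \<times> (real ^ 'm) \<times> (real ^ 'm)"

fun tv_objective :: "real \<Rightarrow> real ^ 'm::finite \<Rightarrow> 'm primal \<Rightarrow> real" where
  "tv_objective lam b (dx, dy, w, u, v) =
     lam * (\<Sum>i\<in>UNIV. norm (dx $ i, dy $ i)) + 1 / 2 * (norm (u - b))\<^sup>2"

fun tv_feasible :: "real ^ 'm ^ 'm \<Rightarrow> real ^ 'm ^ 'm \<Rightarrow> 'm::finite primal \<Rightarrow> bool" where
  "tv_feasible D P (dx, dy, w, u, v) \<longleftrightarrow>
     dx = D *v u \<and> dy = transpose P *v (D *v v) \<and> u = w \<and> v = P *v w"

definition tv_optimal_solution ::
  "real ^ 'm ^ 'm \<Rightarrow> real ^ 'm ^ 'm \<Rightarrow> real \<Rightarrow> real ^ 'm \<Rightarrow> 'm::finite primal \<Rightarrow> bool" where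
  "tv_optimal_solution D P lam b z \<longleftrightarrow>
     tv_feasible D P z \<and>
     (\<forall>z'. tv_feasible D P z' \<longrightarrow> tv_objective lam b z \<le> tv_objective lam b z')"

fun tv_lagrangian ::
  "real ^ 'm ^ 'm \<Rightarrow> real ^ 'm ^ 'm \<Rightarrow> real \<Rightarrow> real ^ 'm \<Rightarrow> 'm::finite primal \<Rightarrow> 'm dual \<Rightarrow> real"
where
  "tv_lagrangian D P lam b (dx, dy, w, u, v) (gx, gy, gu, gv) =
     lam * (\<Sum>i\<in>UNIV. norm (dx $ i, dy $ i)) + 1 / 2 * (norm (u - b))\<^sup>2
     + gx \<bullet> (D *v u - dx) + gy \<bullet> (transpose P *v (D *v v) - dy)
     + gu \<bullet> (u - w) + gv \<bullet> (v - P *v w)"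

definition tv_primal_dual_optimal ::
  "real ^ 'm ^ 'm \<Rightarrow> real ^ 'm ^ 'm \<Rightarrow> real \<Rightarrow> real ^ 'm \<Rightarrow>
     'm::finite primal \<Rightarrow> 'm dual \<Rightarrow> bool" where
  "tv_primal_dual_optimal D P lam b z g \<longleftrightarrow>
     tv_optimal_solution D P lam b z \<and>
     (\<forall>z'. tv_lagrangian D P lam b z g \<le> tv_lagrangian D P lam b z' g)"

end

(*
  The iteration is the two-block alternating direction method of multipliers with blocks
  x = (dx, dy, w) and y = (u, v) and constraint A x = B y. Monotonicity of the subdifferentials
  makes the sequence (multiplier, B y) Fejer monotone with respect to the KKT points, with
  vanishing increments; every cluster point satisfies the KKT conditions in the limit, hence the
  whole sequence converges. A KKT point exists because the dual problem is a projection onto a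
  compact convex set.
*)
theory Submission
  imports Defs
begin

section \<open>Fejer monotone sequences\<close>

text \<open>The two penalties differ, while the abstract argument uses a single Euclidean norm.
  Dividing the constraints by \<open>sqrt \<mu>\<^sub>1\<close> and
  \<open>sqrt \<mu>\<^sub>2\<close> and multiplying the multipliers by the same roots absorbs both.
  The minimizations enter only as subgradient inequalities. Substituting the multiplier updates into
  the linear systems for \<open>u\<close> and \<open>v\<close> turns them into stationarity at the
  new multipliers. The starting data are arbitrary and satisfy no such condition, so the Fejer
  sequence is indexed from the first iterate on. Orthogonality of \<open>P\<close> explains two
  formulas of the algorithm: \<open>P^T P = I\<close> gives the factor 1/2 in the \<open>w\<close>
  update, and \<open>P P^T = I\<close> reduces \<open>D^T P P^T D\<close> to \<open>D^T D\<close> in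
  the \<open>v\<close> system. The Fejer argument controls only images under the constraint maps.
  The iterates themselves are recovered because these maps are injective, although \<open>D\<close>
  is singular: \<open>u\<close> and \<open>v\<close> also occur in the constraints without
  \<open>D\<close>.\<close>

lemma fejer_norm_decrease:
  fixes c s t :: "'a::real_inner"
  assumes "0 \<le> (t - c) \<bullet> (s - t)"
  shows "(norm (t - c))\<^sup>2 + (norm (t - s))\<^sup>2 \<le> (norm (s - c))\<^sup>2"
proof -
  have "(norm (s - c))\<^sup>2 = (norm (t - c))\<^sup>2 + (norm (t - s))\<^sup>2 + 2 * ((t - c) \<bullet> (s - t))"
    by (simp add: power2_norm_eq_inner inner_simps inner_commute)
  then show ?thesis using assms by linarith
qed

text \<open>Opial's argument: the distance to every point of \<open>S\<close> decreases, and a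
  cluster point lying in \<open>S\<close> forces its own distance to vanish. Vanishing increments
  are handed to \<open>limit_points\<close> because membership of a cluster point relates
  consecutive iterates.\<close>

lemma fejer_converges:
  fixes s :: "nat \<Rightarrow> 'a::euclidean_space"
  assumes "c0 \<in> S"
    and fejer: "\<And>c k. c \<in> S \<Longrightarrow> 0 \<le> (s (Suc k) - c) \<bullet> (s k - s (Suc k))"
    and limit_points: "\<And>c r. strict_mono r \<Longrightarrow> (s \<circ> r) \<longlonglongrightarrow> c \<Longrightarrow>
           (\<lambda>k. s (Suc k) - s k) \<longlonglongrightarrow> 0 \<Longrightarrow> c \<in> S"
  obtains c where "c \<in> S" and "s \<longlonglongrightarrow> c"
proof -
  have dec: "(norm (s (Suc k) - c))\<^sup>2 + (norm (s (Suc k) - s k))\<^sup>2 \<le> (norm (s k - c))\<^sup>2"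
    if "c \<in> S" for c k
    using fejer_norm_decrease[OF fejer[OF that]] .
  have antimono: "decseq (\<lambda>k. (norm (s k - c))\<^sup>2)" if "c \<in> S" for c
    using dec[OF that] by (intro decseq_SucI) (smt (verit) zero_le_power2)
  have lim: "\<exists>L. (\<lambda>k. (norm (s k - c))\<^sup>2) \<longlonglongrightarrow> L" if "c \<in> S" for c
    by (rule decseq_convergent[OF antimono[OF that], of 0]) auto
  obtain L where L: "(\<lambda>k. (norm (s k - c0))\<^sup>2) \<longlonglongrightarrow> L"
    using lim[OF \<open>c0 \<in> S\<close>] by blast
  \<comment> \<open>Successive differences of a convergent sequence vanish, and by
    \<open>dec\<close> they dominate the squared increments.\<close>
  have "(\<lambda>k. (norm (s k - c0))\<^sup>2 - (norm (s (Suc k) - c0))\<^sup>2) \<longlonglongrightarrow> 0"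
    using tendsto_diff[OF L LIMSEQ_Suc[OF L]] by simp
  moreover have "\<forall>\<^sub>F k in sequentially.
      norm ((norm (s (Suc k) - s k))\<^sup>2) \<le> (norm (s k - c0))\<^sup>2 - (norm (s (Suc k) - c0))\<^sup>2"
    using dec[OF \<open>c0 \<in> S\<close>] by (intro always_eventually allI) (simp add: le_diff_eq add.commute)
  ultimately have sq: "(\<lambda>k. (norm (s (Suc k) - s k))\<^sup>2) \<longlonglongrightarrow> 0"
    by (rule Lim_null_comparison[rotated])
  have "(\<lambda>k. norm (s (Suc k) - s k)) \<longlonglongrightarrow> 0"
    using tendsto_real_sqrt[OF sq] by simp
  then have diff: "(\<lambda>k. s (Suc k) - s k) \<longlonglongrightarrow> 0"
    by (rule tendsto_norm_zero_cancel)
  have "s k \<in> cball c0 (norm (s 0 - c0))" for k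
    using decseqD[OF antimono[OF \<open>c0 \<in> S\<close>], of 0 k]
    by (simp add: dist_norm norm_minus_commute)
  then have "bounded (range s)"
    by (meson bounded_cball bounded_subset image_subsetI)
  then obtain c r where r: "strict_mono r" "(s \<circ> r) \<longlonglongrightarrow> c"
    using bounded_imp_convergent_subsequence by blast
  have c: "c \<in> S" by (rule limit_points[OF r diff])
  \<comment> \<open>The full sequence of distances to \<open>c\<close> converges, so its limit can
    be read off along the subsequence \<open>r\<close>, where it is 0.\<close>
  obtain L' where L': "(\<lambda>k. (norm (s k - c))\<^sup>2) \<longlonglongrightarrow> L'"
    using lim[OF c] by blast
  have "(\<lambda>k. (norm ((s \<circ> r) k - c))\<^sup>2) \<longlonglongrightarrow> (norm (c - c))\<^sup>2"
    by (intro tendsto_intros r)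
  moreover have "(\<lambda>k. (norm ((s \<circ> r) k - c))\<^sup>2) \<longlonglongrightarrow> L'"
    using LIMSEQ_subseq_LIMSEQ[OF L' r(1)] by (simp add: comp_def)
  ultimately have "L' = (norm (c - c))\<^sup>2" by (rule LIMSEQ_unique[rotated])
  then have "L' = 0" by simp
  then have "(\<lambda>k. norm (s k - c)) \<longlonglongrightarrow> 0"
    using tendsto_real_sqrt[OF L'] by simp
  then have "s \<longlonglongrightarrow> c"
    by (rule tendsto_norm_zero_cancel[THEN LIM_zero_cancel])
  with c show thesis by (rule that)
qed

section \<open>The alternating direction method of multipliers\<close>

text \<open>The conditions say \<open>A\<^sup>T\<gamma> \<in> \<partial>f x\<close> and \<open>-B\<^sup>T\<gamma> \<in> \<partial>g y\<close>.\<close>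

definition kkt_point ::
  "('x::real_vector \<Rightarrow> real) \<Rightarrow> ('y::real_vector \<Rightarrow> real) \<Rightarrow> ('x \<Rightarrow> 'c::real_inner) \<Rightarrow>
     ('y \<Rightarrow> 'c) \<Rightarrow> 'x \<Rightarrow> 'y \<Rightarrow> 'c \<Rightarrow> bool" where
  "kkt_point f g A B x y \<gamma> \<longleftrightarrow> A x = B y \<and>
     (\<forall>x'. f x + \<gamma> \<bullet> A (x' - x) \<le> f x') \<and> (\<forall>y'. g y - \<gamma> \<bullet> B (y' - y) \<le> g y')"

text \<open>A linear left inverse is continuous in finite dimension and carries the convergence back
  from the images.\<close>

lemma tendsto_of_linear_inj_image:
  fixes A :: "'x::euclidean_space \<Rightarrow> 'c::euclidean_space"
  assumes "linear A" "inj A" "(\<lambda>k. A (X k)) \<longlonglongrightarrow> a"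
  obtains x where "X \<longlonglongrightarrow> x" and "A x = a"
proof -
  obtain A' where A': "linear A'" "A' \<circ> A = id"
    using linear_injective_left_inverse[OF assms(1,2)] by blast
  have "(\<lambda>k. A' (A (X k))) \<longlonglongrightarrow> A' a"
    using A'(1) by (intro bounded_linear.tendsto[OF _ assms(3)]) (simp add: linear_conv_bounded_linear)
  then have X: "X \<longlonglongrightarrow> A' a" using A'(2) by (simp add: pointfree_idE)
  then have "(\<lambda>k. A (X k)) \<longlonglongrightarrow> A (A' a)"
    using assms(1) by (intro bounded_linear.tendsto[where f = A]) (simp_all add: linear_conv_bounded_linear)
  then have "A (A' a) = a" using assms(3) by (rule LIMSEQ_unique)
  with X show thesis by (rule that)
qed

text \<open>\<open>x_step\<close> and \<open>y_step\<close> are the optimality conditions of the two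
  subproblems with unit penalty. The multiplier in \<open>x_step\<close> still contains the old
  \<open>Y k\<close>; in \<open>y_step\<close> the penalty term has been absorbed into the updated
  multiplier \<open>\<Gamma> (Suc k)\<close>, so the \<open>y\<close> half of the KKT condition
  holds exactly at each iterate.\<close>

theorem admm_converges:
  fixes A :: "'x::euclidean_space \<Rightarrow> 'c::euclidean_space"
    and B :: "'y::euclidean_space \<Rightarrow> 'c"
  assumes A: "linear A" "inj A" and B: "linear B" "inj B"
    and f: "continuous_on UNIV f" and g: "continuous_on UNIV g"
    and x_step: "\<And>k x. f (X (Suc k)) + (\<Gamma> k + B (Y k) - A (X (Suc k))) \<bullet> A (x - X (Suc k)) \<le> f x"
    and y_step: "\<And>k y. g (Y (Suc k)) - \<Gamma> (Suc k) \<bullet> B (y - Y (Suc k)) \<le> g y"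
    and dual_step: "\<And>k. \<Gamma> (Suc k) = \<Gamma> k + (B (Y (Suc k)) - A (X (Suc k)))"
    and kkt: "kkt_point f g A B x0 y0 \<gamma>0"
  obtains x y \<gamma> where "kkt_point f g A B x y \<gamma>"
    and "(\<lambda>k. X (Suc k)) \<longlonglongrightarrow> x" and "(\<lambda>k. Y (Suc k)) \<longlonglongrightarrow> y" and "(\<lambda>k. \<Gamma> (Suc k)) \<longlonglongrightarrow> \<gamma>"
proof -
  define S where "S = {(\<gamma>, B y) | \<gamma> y. \<exists>x. kkt_point f g A B x y \<gamma>}"
  \<comment> \<open>The shift by one matters: the Fejer inequality needs \<open>y_step\<close> at
    both of two consecutive indices, and nothing is known about \<open>Y 0\<close>.\<close>
  define s where "s k = (\<Gamma> (Suc k), B (Y (Suc k)))" for k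
  have AX: "A (X (Suc k)) = B (Y (Suc k)) - (\<Gamma> (Suc k) - \<Gamma> k)" for k
    by (simp add: dual_step)
  have limit_x: "\<exists>x. (\<lambda>k. X (Suc (Suc (r k)))) \<longlonglongrightarrow> x \<and> A x = \<beta>"
    if "(\<lambda>k. s (r k)) \<longlonglongrightarrow> (\<gamma>, \<beta>)" "(\<lambda>k. s (Suc (r k))) \<longlonglongrightarrow> (\<gamma>, \<beta>)" for r :: "nat \<Rightarrow> nat" and \<gamma> \<beta>
  proof -
    have "(\<lambda>k. B (Y (Suc (Suc (r k)))) - (\<Gamma> (Suc (Suc (r k))) - \<Gamma> (Suc (r k)))) \<longlonglongrightarrow> \<beta> - (\<gamma> - \<gamma>)"
      using tendsto_fst[OF that(1)] tendsto_fst[OF that(2)] tendsto_snd[OF that(2)]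
      unfolding s_def fst_conv snd_conv by (intro tendsto_intros)
    then have "(\<lambda>k. A (X (Suc (Suc (r k))))) \<longlonglongrightarrow> \<beta>"
      by (simp add: AX)
    then obtain x where "(\<lambda>k. X (Suc (Suc (r k)))) \<longlonglongrightarrow> x" "A x = \<beta>"
      by (rule tendsto_of_linear_inj_image[OF A])
    then show ?thesis by (intro exI conjI)
  qed
  have fejer: "0 \<le> (s (Suc k) - c) \<bullet> (s k - s (Suc k))" if "c \<in> S" for c k
  proof -
    obtain \<gamma> y x where c: "c = (\<gamma>, B y)" and K: "kkt_point f g A B x y \<gamma>"
      using \<open>c \<in> S\<close> by (auto simp: S_def)
    let ?X = "X (Suc (Suc k))" and ?Y = "Y (Suc (Suc k))" and ?Z = "Y (Suc k)"
    let ?G = "\<Gamma> (Suc (Suc k))" and ?H = "\<Gamma> (Suc k)"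
    have 1: "f ?X + (?H + B ?Z - A ?X) \<bullet> A (x - ?X) \<le> f x" "f x + \<gamma> \<bullet> A (?X - x) \<le> f ?X"
      using x_step K by (auto simp: kkt_point_def)
    have 2: "g ?Y - ?G \<bullet> B (y - ?Y) \<le> g y" "g y - \<gamma> \<bullet> B (?Y - y) \<le> g ?Y"
      using y_step K by (auto simp: kkt_point_def)
    \<comment> \<open>Adding the inequalities of 1 and 2 leaves the cross term
      \<open>(?G - ?H) \<bullet> (B ?Z - B ?Y)\<close>. Monotonicity between successive
      \<open>Y\<close> iterates gives its sign.\<close>
    have 3: "g ?Y - ?G \<bullet> B (?Z - ?Y) \<le> g ?Z" "g ?Z - ?H \<bullet> B (?Y - ?Z) \<le> g ?Y"
      using y_step by auto
    have e: "A x = B y" using K by (simp add: kkt_point_def)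
    show ?thesis
      using 1 2 3
      by (simp add: s_def c linear_diff[OF A(1)] linear_diff[OF B(1)] AX[of "Suc k"] e
          inner_simps inner_commute)
  qed
  have limits: "c \<in> S"
    if r: "strict_mono r" and sr: "(s \<circ> r) \<longlonglongrightarrow> c" and d: "(\<lambda>k. s (Suc k) - s k) \<longlonglongrightarrow> 0" for c r
  proof -
    obtain \<gamma> \<beta> where c: "c = (\<gamma>, \<beta>)" by fastforce
    have s1: "(\<lambda>k. s (r k)) \<longlonglongrightarrow> (\<gamma>, \<beta>)" using sr by (simp add: comp_def c)
    have "(\<lambda>k. (s (Suc (r k)) - s (r k)) + s (r k)) \<longlonglongrightarrow> 0 + (\<gamma>, \<beta>)"
      using LIMSEQ_subseq_LIMSEQ[OF d r] by (intro tendsto_add s1) (simp add: comp_def)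
    then have s2: "(\<lambda>k. s (Suc (r k))) \<longlonglongrightarrow> (\<gamma>, \<beta>)" by simp
    obtain x where X: "(\<lambda>k. X (Suc (Suc (r k)))) \<longlonglongrightarrow> x" and x: "A x = \<beta>"
      using limit_x[OF s1 s2] by blast
    have G1: "(\<lambda>k. \<Gamma> (Suc (r k))) \<longlonglongrightarrow> \<gamma>" and B1: "(\<lambda>k. B (Y (Suc (r k)))) \<longlonglongrightarrow> \<beta>"
      using tendsto_fst[OF s1] tendsto_snd[OF s1] by (simp_all add: s_def)
    obtain y where Y: "(\<lambda>k. Y (Suc (r k))) \<longlonglongrightarrow> y" and y: "B y = \<beta>"
      using tendsto_of_linear_inj_image[OF B B1] .
    have contA: "isCont A z" for z
      using A(1) by (simp add: linear_continuous_at linear_conv_bounded_linear)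
    have contB: "isCont B z" for z
      using B(1) by (simp add: linear_continuous_at linear_conv_bounded_linear)
    have contf: "isCont f z" and contg: "isCont g z'" for z z'
      using f g by (simp_all add: continuous_on_eq_continuous_at)
    have "f x + \<gamma> \<bullet> A (x' - x) \<le> f x'" for x'
    proof -
      \<comment> \<open>In the limit the stale terms \<open>B (Y _)\<close> and
        \<open>A (X _)\<close> cancel, since both tend to \<open>\<beta>\<close>; only
        \<open>\<gamma>\<close> remains as multiplier.\<close>
      have "(\<lambda>k. f (X (Suc (Suc (r k)))) + (\<Gamma> (Suc (r k)) + B (Y (Suc (r k))) - A (X (Suc (Suc (r k)))))
              \<bullet> A (x' - X (Suc (Suc (r k))))) \<longlonglongrightarrow> f x + (\<gamma> + \<beta> - A x) \<bullet> A (x' - x)"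
        by (intro tendsto_intros isCont_tendsto_compose[OF contA] isCont_tendsto_compose[OF contf]
            X G1 B1)
      then have "f x + (\<gamma> + \<beta> - A x) \<bullet> A (x' - x) \<le> f x'"
        by (rule LIMSEQ_le_const2) (intro exI allI impI x_step)
      then show ?thesis by (simp add: x)
    qed
    moreover have "g y - \<gamma> \<bullet> B (y' - y) \<le> g y'" for y'
    proof -
      have "(\<lambda>k. g (Y (Suc (r k))) - \<Gamma> (Suc (r k)) \<bullet> B (y' - Y (Suc (r k))))
              \<longlonglongrightarrow> g y - \<gamma> \<bullet> B (y' - y)"
        by (intro tendsto_intros isCont_tendsto_compose[OF contB] isCont_tendsto_compose[OF contg]
            Y G1)
      then show ?thesis
        by (rule LIMSEQ_le_const2) (intro exI allI impI y_step)
    qed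
    ultimately have "kkt_point f g A B x y \<gamma>" by (simp add: kkt_point_def x y)
    then show ?thesis by (auto simp: S_def c y[symmetric])
  qed
  have "(\<gamma>0, B y0) \<in> S" using kkt by (auto simp: S_def)
  then obtain c where c: "c \<in> S" and sc: "s \<longlonglongrightarrow> c"
    by (rule fejer_converges[where s = s, OF _ fejer limits])
  obtain \<gamma> y x where c_eq: "c = (\<gamma>, B y)" and K: "kkt_point f g A B x y \<gamma>"
    using c by (auto simp: S_def)
  have sc': "(\<lambda>k. s k) \<longlonglongrightarrow> (\<gamma>, B y)" using sc by (simp add: c_eq)
  have G: "(\<lambda>k. \<Gamma> (Suc k)) \<longlonglongrightarrow> \<gamma>" and BY: "(\<lambda>k. B (Y (Suc k))) \<longlonglongrightarrow> B y"
    using tendsto_fst[OF sc'] tendsto_snd[OF sc'] by (simp_all add: s_def)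
  obtain y' where "(\<lambda>k. Y (Suc k)) \<longlonglongrightarrow> y'" and "B y' = B y"
    using tendsto_of_linear_inj_image[OF B BY] .
  then have Y: "(\<lambda>k. Y (Suc k)) \<longlonglongrightarrow> y" by (simp add: inj_eq[OF B(2)])
  obtain x' where X: "(\<lambda>k. X (Suc (Suc k))) \<longlonglongrightarrow> x'" and "A x' = B y"
    using limit_x[of "\<lambda>k. k", OF sc' LIMSEQ_Suc[OF sc']] by blast
  then have "x' = x" using K by (intro injD[OF A(2)]) (simp add: kkt_point_def)
  then have "(\<lambda>k. X (Suc k)) \<longlonglongrightarrow> x"
    using X LIMSEQ_imp_Suc[of "\<lambda>k. X (Suc k)"] by simp
  with K Y G show thesis by (intro that)
qed

section \<open>Soft thresholding as a proximal map\<close>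

text \<open>Soft thresholding is the proximal map of \<open>t * norm\<close>, so the residual is a
  subgradient there. Either the result is 0 and the residual \<open>z\<close> has norm at most
  \<open>t\<close>, or the residual has norm \<open>t\<close> and points in the direction of the
  result.\<close>

lemma soft_threshold_prox:
  assumes "0 \<le> t"
  shows "t * norm (soft_threshold z t) + (z - soft_threshold z t) \<bullet> (x - soft_threshold z t) \<le> t * norm x"
proof (cases "norm z \<le> t")
  case True
  then have "soft_threshold z t = 0" by (simp add: soft_threshold_def)
  moreover have "z \<bullet> x \<le> t * norm x"
    using norm_cauchy_schwarz[of z x] True by (meson mult_right_mono norm_ge_zero order_trans)
  ultimately show ?thesis by simp
next
  case False
  then have z: "norm z > 0" "norm z > t" using assms by auto
  define s where "s = soft_threshold z t"
  have s: "s = ((norm z - t) / norm z) *\<^sub>R z" using z by (auto simp: s_def soft_threshold_def)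
  have zs: "z - s = (t / norm z) *\<^sub>R z" using z by (simp add: s diff_divide_distrib algebra_simps)
  have ns: "norm s = norm z - t" using z by (simp add: s)
  have "(t / norm z) * (z \<bullet> x) \<le> (t / norm z) * (norm z * norm x)"
    using assms z by (intro mult_left_mono norm_cauchy_schwarz) auto
  then have "(z - s) \<bullet> x \<le> t * norm x" using z by (simp add: zs)
  moreover have "(z - s) \<bullet> s = t * norm s"
    using z unfolding zs ns by (simp add: s power2_norm_eq_inner[symmetric] power2_eq_square)
  ultimately show ?thesis
    unfolding s_def[symmetric] by (simp add: inner_diff_right)
qed

lemma inner_vec_pair: "p \<bullet> d + q \<bullet> e = (\<Sum>i\<in>UNIV. (p $ i, q $ i) \<bullet> (d $ i, e $ i))"
  for p q d e :: "real ^ 'm::finite"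
  by (simp add: inner_vec_def sum.distrib)

lemma block_soft_threshold_prox:
  fixes p q a c x y :: "real ^ 'm::finite"
  assumes "0 \<le> t" and "(a, c) = block_soft_threshold (p, q) t"
  shows "t * (\<Sum>i\<in>UNIV. norm (a $ i, c $ i)) + (p - a) \<bullet> (x - a) + (q - c) \<bullet> (y - c)
    \<le> t * (\<Sum>i\<in>UNIV. norm (x $ i, y $ i))"
proof -
  have eq: "(a $ i, c $ i) = soft_threshold (p $ i, q $ i) t" for i
    using assms(2) by (simp add: block_soft_threshold_def)
  have "t * norm (a $ i, c $ i) + ((p - a) $ i, (q - c) $ i) \<bullet> ((x - a) $ i, (y - c) $ i)
      \<le> t * norm (x $ i, y $ i)" for i
    using soft_threshold_prox[OF assms(1), of "(p $ i, q $ i)" "(x $ i, y $ i)"]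
    unfolding eq[symmetric] by simp
  then have "(\<Sum>i\<in>UNIV. t * norm (a $ i, c $ i) + ((p - a) $ i, (q - c) $ i) \<bullet> ((x - a) $ i, (y - c) $ i))
      \<le> (\<Sum>i\<in>UNIV. t * norm (x $ i, y $ i))"
    by (intro sum_mono)
  then show ?thesis
    unfolding add.assoc inner_vec_pair by (simp only: sum.distrib sum_distrib_left)
qed

section \<open>The matrices of the problem\<close>

text \<open>These rules trade transposes for \<open>v*\<close>; without them
  \<open>transpose A *v x\<close> stays in the form that the adjoint lemmas below rewrite.\<close>

declare transpose_matrix_vector [simp del] vector_transpose_matrix [simp del]

lemma inner_transpose_mult: "(transpose A *v x) \<bullet> y = x \<bullet> (A *v y)"
  for A :: "real ^ 'n ^ 'm"
  by (simp add: transpose_matrix_vector dot_lmul_matrix)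

lemma inner_mult_transpose: "x \<bullet> (transpose A *v y) = (A *v x) \<bullet> y"
  for A :: "real ^ 'n ^ 'm"
  using inner_transpose_mult[of A y x] by (simp add: inner_commute)

text \<open>The matrix is positive definite, hence injective, and being square also
  surjective.\<close>

lemma ex1_regularized_normal_equation:
  fixes D :: "real ^ 'n ^ 'm"
  assumes "c > 0"
  shows "\<exists>!x. (transpose D ** D + c *\<^sub>R mat 1) *v x = r"
proof -
  let ?M = "transpose D ** D + c *\<^sub>R mat 1"
  have M: "?M *v x = transpose D *v (D *v x) + c *\<^sub>R x" for x
    by (simp add: matrix_vector_mult_add_rdistrib matrix_vector_mul_assoc
        scaleR_matrix_vector_assoc[symmetric])
  have "x = 0" if "?M *v x = 0" for x
  proof -
    have "(norm (D *v x))\<^sup>2 + c * (norm x)\<^sup>2 = (?M *v x) \<bullet> x"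
      unfolding M by (simp add: inner_add_left inner_transpose_mult power2_norm_eq_inner)
    then have "c * (norm x)\<^sup>2 \<le> 0"
      using that by (smt (verit) inner_zero_left zero_le_power2)
    then show ?thesis using assms by (simp add: mult_le_0_iff)
  qed
  then have inj: "inj ((*v) ?M)"
    by (simp add: linear_injective_0 matrix_vector_mul_linear)
  then have "surj ((*v) ?M)"
    using linear_injective_imp_surjective matrix_vector_mul_linear by blast
  with inj show ?thesis by (metis injD surjD)
qed

section \<open>Coordinate numbering and orthogonality of the row-major permutation\<close>

lemma bij_betw_position:
  "bij_betw position (UNIV :: 'm::{finite,linorder} set) {1..CARD('m)}"
proof -
  have "position k < position l" if "k < l" for k l :: 'm
    unfolding position_def using that by (intro psubset_card_mono) auto
  then have inj: "inj (position :: 'm \<Rightarrow> nat)"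
    by (metis linorder_injI nat_neq_iff)
  have "position k \<in> {1..CARD('m)}" for k :: 'm
    unfolding position_def by (auto simp: Suc_le_eq card_gt_0_iff intro!: card_mono)
  then have "range (position :: 'm \<Rightarrow> nat) \<subseteq> {1..CARD('m)}" by blast
  moreover have "card (range (position :: 'm \<Rightarrow> nat)) = CARD('m)"
    using inj by (simp add: card_image)
  ultimately have "range (position :: 'm \<Rightarrow> nat) = {1..CARD('m)}"
    by (intro card_subset_eq) auto
  with inj show ?thesis by (simp add: bij_betw_def)
qed

lemma div_mod_index_eq:
  fixes i j n :: nat
  assumes "i \<in> {1..n}" "j \<in> {1..n}" "k = j + (i - 1) * n"
  shows "i = (k - 1) div n + 1" "j = (k - 1) mod n + 1"
proof -
  have "k - 1 = (j - 1) + (i - 1) * n" "j - 1 < n" using assms by auto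
  then have "(k - 1) div n = i - 1" "(k - 1) mod n = j - 1" by simp_all
  then show "i = (k - 1) div n + 1" "j = (k - 1) mod n + 1" using assms by auto
qed

text \<open>The relation \<open>R\<close> exchanges pixel \<open>(i, j)\<close> with
  \<open>(j, i)\<close>. It is symmetric and pairs each coordinate with exactly one other or itself,
  so each column of the matrix has a single 1, in a row of its own.\<close>

lemma orthogonal_row_major_perm:
  assumes card: "CARD('m::{finite,linorder}) = n\<^sup>2"
  shows "orthogonal_matrix (row_major_perm n :: real ^ 'm::{finite,linorder} ^ 'm::{finite,linorder})"
proof -
  define R :: "'m \<Rightarrow> 'm \<Rightarrow> bool" where
    "R k l \<longleftrightarrow> (\<exists>i\<in>{1..n}. \<exists>j\<in>{1..n}. position k = j + (i - 1) * n \<and> position l = i + (j - 1) * n)"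
    for k l
  have sym: "R l k" if "R k l" for k l using that unfolding R_def by blast
  have unique: "l = l'" if "R k l" "R k l'" for k l l'
  proof -
    have "position l = position l'"
      using that unfolding R_def by (metis div_mod_index_eq)
    then show ?thesis using bij_betw_position by (auto simp: bij_betw_def dest: injD)
  qed
  have total: "\<exists>l. R k l" for k
  proof -
    define i j where "i = (position k - 1) div n + 1" and "j = (position k - 1) mod n + 1"
    have "position k \<in> {1..n\<^sup>2}"
      using bij_betw_position[where 'm='m] card by (auto simp: bij_betw_def)
    then have pos: "1 \<le> position k" "position k - 1 < n * n" by (auto simp: power2_eq_square)
    then have n: "n > 0" by (cases n) auto
    have ij: "i \<in> {1..n}" "j \<in> {1..n}"
      using pos n by (auto simp: i_def j_def Suc_le_eq less_mult_imp_div_less)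
    have k: "position k = j + (i - 1) * n"
      using pos by (simp add: i_def j_def)
    have "i + (j - 1) * n \<le> n + (n - 1) * n"
      using ij by (intro add_mono mult_right_mono) auto
    also have "\<dots> = n\<^sup>2" using n by (cases n) (auto simp: power2_eq_square)
    finally have "i + (j - 1) * n \<in> {1..CARD('m)}" using ij card by auto
    then obtain l :: 'm where "position l = i + (j - 1) * n"
      using bij_betw_position[where 'm='m] by (metis bij_betw_def imageE)
    with ij k show ?thesis unfolding R_def by blast
  qed
  have P: "row_major_perm n $ k $ l = (if R k l then 1 else (0::real))" for k l
    by (simp add: row_major_perm_def R_def)
  have "(transpose (row_major_perm n) ** row_major_perm n) $ k $ l = (mat 1 :: real ^ 'm::{finite,linorder} ^ 'm::{finite,linorder}) $ k $ l"
    for k l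
  proof -
    obtain m where m: "R k m" using total by blast
    have Rk: "R x k \<longleftrightarrow> x = m" for x using m sym unique by blast
    have Rl: "R m l \<longleftrightarrow> l = k" using m sym unique by blast
    have "(transpose (row_major_perm n) ** row_major_perm n) $ k $ l
        = (\<Sum>x\<in>UNIV. if x = m then (if R x l then 1 else (0::real)) else 0)"
      unfolding matrix_matrix_mult_def by (auto simp: transpose_def P Rk intro!: sum.cong simp del: sum.delta)
    also have "\<dots> = (if l = k then 1 else 0)" by (simp add: Rl)
    finally show ?thesis by (simp add: mat_def eq_commute)
  qed
  then show ?thesis by (simp add: orthogonal_matrix vec_eq_iff)
qed

section \<open>Total variation denoising as a two-block problem\<close>

fun tv_reg :: "real \<Rightarrow> (real ^ 'm::finite) \<times> (real ^ 'm) \<times> (real ^ 'm) \<Rightarrow> real" where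
  "tv_reg lam (dx, dy, w) = lam * (\<Sum>i\<in>UNIV. norm (dx $ i, dy $ i))"

fun tv_fit :: "real ^ 'm::finite \<Rightarrow> (real ^ 'm) \<times> (real ^ 'm) \<Rightarrow> real" where
  "tv_fit b (u, v) = 1 / 2 * (norm (u - b))\<^sup>2"

text \<open>The constraints are divided by \<open>\<surd>\<mu>\<^sub>1\<close> and \<open>\<surd>\<mu>\<^sub>2\<close>, so that the two penalty parameters
  of the augmented Lagrangian become one.\<close>

fun tv_left ::
  "real ^ 'm ^ 'm \<Rightarrow> real \<Rightarrow> real \<Rightarrow> (real ^ 'm::finite) \<times> (real ^ 'm) \<times> (real ^ 'm) \<Rightarrow> 'm dual"
where
  "tv_left P a c (dx, dy, w) =
     ((1 / a) *\<^sub>R dx, (1 / a) *\<^sub>R dy, (1 / c) *\<^sub>R w, (1 / c) *\<^sub>R (P *v w))"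

fun tv_right ::
  "real ^ 'm ^ 'm \<Rightarrow> real ^ 'm ^ 'm \<Rightarrow> real \<Rightarrow> real \<Rightarrow> (real ^ 'm::finite) \<times> (real ^ 'm) \<Rightarrow> 'm dual"
where
  "tv_right D P a c (u, v) =
     ((1 / a) *\<^sub>R (D *v u), (1 / a) *\<^sub>R (transpose P *v (D *v v)), (1 / c) *\<^sub>R u, (1 / c) *\<^sub>R v)"

lemma linear_tv_left: "linear (tv_left P a c)"
  by (rule linearI) (auto simp: algebra_simps matrix_vector_right_distrib matrix_vector_mult_scaleR)

lemma linear_tv_right: "linear (tv_right D P a c)"
  by (rule linearI) (auto simp: algebra_simps matrix_vector_right_distrib matrix_vector_mult_scaleR)

lemma inj_tv_left: "a \<noteq> 0 \<Longrightarrow> c \<noteq> 0 \<Longrightarrow> inj (tv_left P a c)"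
  by (rule injI) auto

lemma inj_tv_right: "c \<noteq> 0 \<Longrightarrow> inj (tv_right D P a c)"
  by (rule injI) auto

lemma continuous_on_tv_reg: "continuous_on UNIV (tv_reg lam)"
proof -
  have eq: "tv_reg lam = (\<lambda>x. lam * (\<Sum>i\<in>UNIV. norm (fst x $ i, fst (snd x) $ i)))"
    by auto
  show ?thesis unfolding eq by (intro continuous_intros)
qed

lemma continuous_on_tv_fit: "continuous_on UNIV (tv_fit b)"
proof -
  have eq: "tv_fit b = (\<lambda>y. 1 / 2 * (norm (fst y - b))\<^sup>2)" by auto
  show ?thesis unfolding eq by (intro continuous_intros)
qed

lemma tv_fit_subgradient: "tv_fit b (u, v) + (u - b) \<bullet> (u' - u) \<le> tv_fit b (u', v')"
proof -
  have "(norm (u' - b))\<^sup>2 = (norm (u - b))\<^sup>2 + 2 * ((u - b) \<bullet> (u' - u)) + (norm (u' - u))\<^sup>2"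
    by (simp add: power2_norm_eq_inner inner_simps inner_commute)
  then show ?thesis by simp
qed

text \<open>The scalings cancel against those in \<open>tv_right\<close>, so the adjoint of
  \<open>tv_right\<close> sends the scaled multiplier to \<open>(b - u, 0)\<close>, which is minus
  the gradient of \<open>tv_fit b\<close> at \<open>(u, v)\<close>. This serves both the iterates
  and the constructed KKT point.\<close>

lemma tv_fit_stationary:
  assumes u: "transpose D *v gx + gu = b - u" and v: "transpose D *v (P *v gy) + gv = 0"
    and "a \<noteq> 0" "c \<noteq> 0"
  shows "tv_fit b (u, v) - (a *\<^sub>R gx, a *\<^sub>R gy, c *\<^sub>R gu, c *\<^sub>R gv) \<bullet> tv_right D P a c (y - (u, v))
    \<le> tv_fit b y"
proof -
  obtain u' v' where y: "y = (u', v')" by fastforce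
  have "gy \<bullet> (transpose P *v (D *v z)) = (transpose D *v (P *v gy)) \<bullet> z" for z
    by (simp add: inner_transpose_mult inner_mult_transpose)
  then have "(a *\<^sub>R gx, a *\<^sub>R gy, c *\<^sub>R gu, c *\<^sub>R gv) \<bullet> tv_right D P a c (y - (u, v))
      = (transpose D *v gx + gu) \<bullet> (u' - u) + (transpose D *v (P *v gy) + gv) \<bullet> (v' - v)"
    using assms(3,4) by (simp add: y inner_transpose_mult inner_add_left)
  also have "\<dots> = - ((u - b) \<bullet> (u' - u))"
    unfolding u v by (simp add: inner_diff_left)
  finally show ?thesis using tv_fit_subgradient[of b u v u' v'] by (simp add: y)
qed

text \<open>The sum of the two subgradient inequalities is minimality of the Lagrangian. Since the
  Lagrangian agrees with the objective on feasible points, primal optimality follows.\<close>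

lemma tv_primal_dual_optimal_if_kkt:
  assumes "a \<noteq> 0" "c \<noteq> 0"
    and kkt: "kkt_point (tv_reg lam) (tv_fit b) (tv_left P a c) (tv_right D P a c)
            (dx, dy, w) (u, v) (a *\<^sub>R gx, a *\<^sub>R gy, c *\<^sub>R gu, c *\<^sub>R gv)"
  shows "tv_primal_dual_optimal D P lam b (dx, dy, w, u, v) (gx, gy, gu, gv)"
proof -
  let ?z = "(dx, dy, w, u, v)" and ?g = "(gx, gy, gu, gv)"
  have feas: "tv_feasible D P ?z"
    using kkt assms(1,2) by (auto simp: kkt_point_def)
  have lag: "tv_lagrangian D P lam b ?z ?g \<le> tv_lagrangian D P lam b z' ?g" for z'
  proof -
    obtain dx' dy' w' u' v' where z': "z' = (dx', dy', w', u', v')" by (metis prod.exhaust)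
    have "tv_reg lam (dx, dy, w) + (gx \<bullet> (dx' - dx) + gy \<bullet> (dy' - dy) + gu \<bullet> (w' - w) + gv \<bullet> (P *v (w' - w)))
        \<le> tv_reg lam (dx', dy', w')"
      using kkt assms(1,2) unfolding kkt_point_def
      by (auto dest!: spec[where x = "(dx', dy', w')"] simp del: tv_reg.simps simp: add.assoc)
    moreover have "tv_fit b (u, v) - (gx \<bullet> (D *v (u' - u)) + gy \<bullet> (transpose P *v (D *v (v' - v)))
        + gu \<bullet> (u' - u) + gv \<bullet> (v' - v)) \<le> tv_fit b (u', v')"
      using kkt assms(1,2) unfolding kkt_point_def
      by (auto dest!: spec[where x = "(u', v')"] simp del: tv_fit.simps simp: add.assoc)
    ultimately show ?thesis
      using feas by (simp add: z' inner_simps matrix_vector_mult_diff_distrib algebra_simps)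
  qed
  have eq: "tv_lagrangian D P lam b z' ?g = tv_objective lam b z'" if "tv_feasible D P z'" for z'
    using that by (cases z') auto
  show ?thesis
    unfolding tv_primal_dual_optimal_def tv_optimal_solution_def
    using feas lag eq by metis
qed

section \<open>Existence of a KKT point by duality\<close>

lemma inner_sgn_self: "sgn z \<bullet> z = norm z" for z :: "'a::real_inner"
  by (cases "z = 0")
    (simp_all add: sgn_div_norm power2_norm_eq_inner[symmetric] power2_eq_square)

text \<open>Together with \<open>multiplier_inner_le\<close> this identifies the regularizer as the
  support function of the set of multipliers with blocks bounded by \<open>lam\<close>. Zero blocks
  cause no trouble because \<open>sgn 0 = 0\<close>.\<close>

lemma ex_aligned_multiplier:
  fixes d e :: "real ^ 'm::finite"
  assumes "0 \<le> lam"
  obtains p q where "\<And>i. norm (p $ i, q $ i) \<le> lam"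
    and "p \<bullet> d + q \<bullet> e = lam * (\<Sum>i\<in>UNIV. norm (d $ i, e $ i))"
proof -
  define p q where "p = (\<chi> i. lam * fst (sgn (d $ i, e $ i)))"
    and "q = (\<chi> i. lam * snd (sgn (d $ i, e $ i)))"
  have pq: "(p $ i, q $ i) = lam *\<^sub>R sgn (d $ i, e $ i)" for i
    by (simp add: p_def q_def prod_eq_iff)
  have "norm (p $ i, q $ i) \<le> lam" for i
    unfolding pq using assms by (simp add: norm_sgn)
  moreover have "(p $ i, q $ i) \<bullet> (d $ i, e $ i) = lam * norm (d $ i, e $ i)" for i
    unfolding pq by (simp only: inner_scaleR_left inner_sgn_self)
  ultimately show thesis
    by (intro that) (auto simp only: inner_vec_pair sum_distrib_left)
qed

lemma multiplier_inner_le: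
  fixes p q d e :: "real ^ 'm::finite"
  assumes "\<And>i. norm (p $ i, q $ i) \<le> lam"
  shows "p \<bullet> d + q \<bullet> e \<le> lam * (\<Sum>i\<in>UNIV. norm (d $ i, e $ i))"
  unfolding inner_vec_pair sum_distrib_left
  by (intro sum_mono order_trans[OF norm_cauchy_schwarz] mult_right_mono assms norm_ge_zero)

text \<open>The dual problem is the projection of \<open>b\<close> onto the image of the compact set of multipliers
  whose blocks have norm at most \<open>lam\<close>; the residual of the projection is the primal solution.\<close>

lemma ex_kkt_point:
  fixes D P :: "real ^ 'm::finite ^ 'm"
  assumes "0 \<le> lam" "a \<noteq> 0" "c \<noteq> 0" and P: "orthogonal_matrix P"
  obtains x y \<gamma> where "kkt_point (tv_reg lam) (tv_fit b) (tv_left P a c) (tv_right D P a c) x y \<gamma>"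
proof -
  define C where "C = {pq :: (real ^ 'm) \<times> (real ^ 'm). \<forall>i. norm (fst pq $ i, snd pq $ i) \<le> lam}"
  \<comment> \<open>\<open>L\<close> is the adjoint of the discrete gradient
    \<open>z \<mapsto> (D z, P^T D P z)\<close>, as \<open>adj\<close> confirms.\<close>
  define L :: "(real ^ 'm) \<times> (real ^ 'm) \<Rightarrow> real ^ 'm" where
    "L pq = transpose D *v fst pq + transpose P *v (transpose D *v (P *v snd pq))" for pq
  have L: "linear L"
    by (rule linearI)
      (auto simp: L_def algebra_simps matrix_vector_right_distrib matrix_vector_mult_scaleR)
  have adj: "L (p, q) \<bullet> z = p \<bullet> (D *v z) + q \<bullet> (transpose P *v (D *v (P *v z)))" for p q z
    by (simp add: L_def inner_add_left inner_transpose_mult inner_mult_transpose)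
  have C_Int: "C = (\<Inter>i. (\<lambda>pq. (fst pq $ i, snd pq $ i)) -` cball 0 lam)"
    by (auto simp: C_def)
  have "convex C"
    unfolding C_Int
    by (intro convex_INT convex_linear_vimage convex_cball linearI) auto
  moreover have "closed C"
    unfolding C_Int by (intro closed_INT ballI continuous_closed_vimage closed_cball)
      (auto intro!: continuous_intros)
  moreover have "bounded C"
  proof -
    have "norm pq \<le> (\<Sum>i\<in>(UNIV :: 'm set). lam) + (\<Sum>i\<in>(UNIV :: 'm set). lam)" if "pq \<in> C" for pq
    proof -
      have "norm (fst pq $ i) \<le> lam" "norm (snd pq $ i) \<le> lam" for i
        using that norm_fst_le[of "fst pq $ i" "snd pq $ i"] norm_snd_le[of "snd pq $ i" "fst pq $ i"]
        unfolding C_def by (auto intro: order_trans)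
      then have "norm (fst pq) \<le> (\<Sum>i\<in>(UNIV :: 'm set). lam)" "norm (snd pq) \<le> (\<Sum>i\<in>(UNIV :: 'm set). lam)"
        by (intro order_trans[OF norm_le_l1_cart] sum_mono; simp)+
      then show ?thesis using norm_Pair_le[of "fst pq" "snd pq"] unfolding prod.collapse by linarith
    qed
    then show ?thesis unfolding bounded_iff by blast
  qed
  ultimately have LC: "convex (L ` C)" "closed (L ` C)"
    using L by (auto simp: convex_linear_image compact_eq_bounded_closed linear_continuous_on
        linear_conv_bounded_linear intro!: compact_imp_closed compact_continuous_image)
  have "(0, 0) \<in> C" using assms(1) by (simp add: C_def zero_prod_def[symmetric])
  then have ne: "L ` C \<noteq> {}" by blast
  obtain p q where pq: "(p, q) \<in> C" and proj: "closest_point (L ` C) b = L (p, q)"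
    using closest_point_in_set[OF LC(2) ne, of b] by auto
  define u where "u = b - L (p, q)"
  define v where "v = P *v u"
  define d where "d = D *v u"
  define e where "e = transpose P *v (D *v v)"
  \<comment> \<open>The variational inequality of the projection, moved through the adjoint:
    \<open>(p, q)\<close> maximizes the pairing with the gradient of the residual over
    \<open>C\<close>. Comparison with an aligned multiplier then shows that the maximum is at least
    the regularizer.\<close>
  have le: "p' \<bullet> d + q' \<bullet> e \<le> p \<bullet> d + q \<bullet> e" if "(p', q') \<in> C" for p' q'
  proof -
    have "u \<bullet> (L (p', q') - L (p, q)) \<le> 0"
      using closest_point_dot[OF LC, of "L (p', q')" b] that by (simp add: proj u_def)
    then have "L (p', q') \<bullet> u \<le> L (p, q) \<bullet> u" by (simp add: inner_diff_right inner_commute)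
    then show ?thesis by (simp add: adj d_def e_def v_def)
  qed
  obtain p' q' where pq': "\<And>i. norm (p' $ i, q' $ i) \<le> lam"
    and al: "p' \<bullet> d + q' \<bullet> e = lam * (\<Sum>i\<in>UNIV. norm (d $ i, e $ i))"
    using ex_aligned_multiplier[OF assms(1)] by blast
  have "(p', q') \<in> C" using pq' by (simp add: C_def)
  from le[OF this] have reg: "tv_reg lam (d, e, u) \<le> p \<bullet> d + q \<bullet> e" by (simp add: al)
  \<comment> \<open>\<open>gv\<close> is forced by stationarity in \<open>v\<close>, and
    \<open>gu\<close> by stationarity in \<open>w\<close>, which requires
    \<open>gu + P^T gv = 0\<close>. Stationarity in \<open>u\<close> then reads
    \<open>L (p, q) = b - u\<close>, the definition of \<open>u\<close>.\<close>
  define gv where "gv = - (transpose D *v (P *v q))"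
  define gu where "gu = - (transpose P *v gv)"
  have "tv_reg lam (d, e, u) + (a *\<^sub>R p, a *\<^sub>R q, c *\<^sub>R gu, c *\<^sub>R gv) \<bullet> tv_left P a c (x' - (d, e, u))
      \<le> tv_reg lam x'" for x'
  proof -
    obtain d' e' w' where x': "x' = (d', e', w')" by (metis prod.exhaust)
    have "p \<bullet> d' + q \<bullet> e' \<le> tv_reg lam x'"
      using multiplier_inner_le[of p q lam d' e'] pq by (simp add: C_def x')
    moreover have "(a *\<^sub>R p, a *\<^sub>R q, c *\<^sub>R gu, c *\<^sub>R gv) \<bullet> tv_left P a c (x' - (d, e, u))
        = p \<bullet> (d' - d) + q \<bullet> (e' - e)"
      using assms(2,3) by (simp add: x' gu_def inner_transpose_mult)
    ultimately show ?thesis using reg by (simp add: inner_diff_right)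
  qed
  moreover have "tv_fit b (u, v) - (a *\<^sub>R p, a *\<^sub>R q, c *\<^sub>R gu, c *\<^sub>R gv) \<bullet> tv_right D P a c (y' - (u, v))
      \<le> tv_fit b y'" for y'
    using assms(2,3)
    by (intro tv_fit_stationary)
      (auto simp: gu_def gv_def u_def L_def linear_neg[OF matrix_vector_mul_linear])
  moreover have "tv_left P a c (d, e, u) = tv_right D P a c (u, v)"
    by (simp add: d_def e_def v_def)
  ultimately have "kkt_point (tv_reg lam) (tv_fit b) (tv_left P a c) (tv_right D P a c)
      (d, e, u) (u, v) (a *\<^sub>R p, a *\<^sub>R q, c *\<^sub>R gu, c *\<^sub>R gv)"
    unfolding kkt_point_def by blast
  then show thesis by (rule that)
qed

section \<open>The denoising iteration as an instance of the alternating direction method\<close>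

theorem mainTheorem2:
  fixes n :: nat
    and b :: "real ^ 'm::{finite,linorder}"
    and lam \<mu>\<^sub>1 \<mu>\<^sub>2 :: real
    and D P :: "real ^ 'm::{finite,linorder} ^ 'm::{finite,linorder}"
    and dx dy w u v gx gy gu gv :: "nat \<Rightarrow> real ^ 'm::{finite,linorder}"
  assumes "n \<ge> 2"
    and "CARD('m) = n^2"
    and "lam > 0" and "\<mu>\<^sub>1 > 0" and "\<mu>\<^sub>2 > 0"
    and "D = diff_matrix n"
    and "P = row_major_perm n"
    and "\<And>k. (dx (Suc k), dy (Suc k)) =
           block_soft_threshold
             (D *v u k + \<mu>\<^sub>1 *\<^sub>R gx k, transpose P *v (D *v v k) + \<mu>\<^sub>1 *\<^sub>R gy k) (lam * \<mu>\<^sub>1)"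
    and "\<And>k. w (Suc k) =
           (1 / 2) *\<^sub>R (u k + transpose P *v v k + \<mu>\<^sub>2 *\<^sub>R (gu k + transpose P *v gv k))"
    and "\<And>k. v (Suc k) =
           (THE x. (transpose D ** D + (\<mu>\<^sub>1 / \<mu>\<^sub>2) *\<^sub>R mat 1) *v x =
              \<mu>\<^sub>1 *\<^sub>R ((1 / \<mu>\<^sub>2) *\<^sub>R (P *v w (Suc k)) - gv k)
              + transpose D *v (P *v (dy (Suc k) - \<mu>\<^sub>1 *\<^sub>R gy k)))"
    and "\<And>k. u (Suc k) =
           (THE x. (transpose D ** D + (\<mu>\<^sub>1 + \<mu>\<^sub>1 / \<mu>\<^sub>2) *\<^sub>R mat 1) *v x =
              \<mu>\<^sub>1 *\<^sub>R (b - gu k + (1 / \<mu>\<^sub>2) *\<^sub>R w (Suc k))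
              + transpose D *v (dx (Suc k) - \<mu>\<^sub>1 *\<^sub>R gx k))"
    and "\<And>k. gx (Suc k) = gx k + (1 / \<mu>\<^sub>1) *\<^sub>R (D *v u (Suc k) - dx (Suc k))"
    and "\<And>k. gy (Suc k) =
           gy k + (1 / \<mu>\<^sub>1) *\<^sub>R (transpose P *v (D *v v (Suc k)) - dy (Suc k))"
    and "\<And>k. gu (Suc k) = gu k + (1 / \<mu>\<^sub>2) *\<^sub>R (u (Suc k) - w (Suc k))"
    and "\<And>k. gv (Suc k) = gv k + (1 / \<mu>\<^sub>2) *\<^sub>R (v (Suc k) - P *v w (Suc k))"
  shows "(\<forall>r. \<exists>!x. (transpose D ** D + (\<mu>\<^sub>1 / \<mu>\<^sub>2) *\<^sub>R mat 1) *v x = r) \<and>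
    (\<forall>r. \<exists>!x. (transpose D ** D + (\<mu>\<^sub>1 + \<mu>\<^sub>1 / \<mu>\<^sub>2) *\<^sub>R mat 1) *v x = r) \<and>
    (\<exists>z g. tv_primal_dual_optimal D P lam b z g \<and>
      (\<lambda>k. ((dx (Suc k), dy (Suc k), w (Suc k), u (Suc k), v (Suc k)),
            (gx (Suc k), gy (Suc k), gu (Suc k), gv (Suc k)))) \<longlonglongrightarrow> (z, g))"
  proof -
  let ?a = "sqrt \<mu>\<^sub>1" and ?c = "sqrt \<mu>\<^sub>2"
  have nz: "?a \<noteq> 0" "?c \<noteq> 0" and sq: "?a * ?a = \<mu>\<^sub>1" "?c * ?c = \<mu>\<^sub>2"
    using assms(4,5) by auto
  have orth: "orthogonal_matrix P"
    unfolding assms(7) by (rule orthogonal_row_major_perm[OF assms(2)])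
  have PtP: "transpose P *v (P *v z) = z" and PPt: "P *v (transpose P *v z) = z" for z
    using orth by (simp_all add: orthogonal_matrix_def matrix_vector_mul_assoc)
  note prox = assms(8) and w_step = assms(9) and v_def = assms(10) and u_def = assms(11)
    and dual = assms(12-15)
  have ex1: "\<exists>!x. (transpose D ** D + (\<mu>\<^sub>1 / \<mu>\<^sub>2) *\<^sub>R mat 1) *v x = r"
    "\<exists>!x. (transpose D ** D + (\<mu>\<^sub>1 + \<mu>\<^sub>1 / \<mu>\<^sub>2) *\<^sub>R mat 1) *v x = r" for r
    using assms(4,5) by (auto intro!: ex1_regularized_normal_equation add_pos_pos)
  have M: "(transpose D ** D + s *\<^sub>R mat 1) *v x = transpose D *v (D *v x) + s *\<^sub>R x" for s x
    by (simp add: matrix_vector_mult_add_rdistrib matrix_vector_mul_assoc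
        scaleR_matrix_vector_assoc[symmetric])
  have v_step: "transpose D *v (D *v v (Suc k)) + (\<mu>\<^sub>1 / \<mu>\<^sub>2) *\<^sub>R v (Suc k) =
      \<mu>\<^sub>1 *\<^sub>R ((1 / \<mu>\<^sub>2) *\<^sub>R (P *v w (Suc k)) - gv k)
        + transpose D *v (P *v (dy (Suc k) - \<mu>\<^sub>1 *\<^sub>R gy k))" for k
    unfolding M[symmetric] by (subst (1) v_def, rule theI'[OF ex1(1)])
  have u_step: "transpose D *v (D *v u (Suc k)) + (\<mu>\<^sub>1 + \<mu>\<^sub>1 / \<mu>\<^sub>2) *\<^sub>R u (Suc k) =
      \<mu>\<^sub>1 *\<^sub>R (b - gu k + (1 / \<mu>\<^sub>2) *\<^sub>R w (Suc k))
        + transpose D *v (dx (Suc k) - \<mu>\<^sub>1 *\<^sub>R gx k)" for k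
    unfolding M[symmetric] by (subst (1) u_def, rule theI'[OF ex1(2)])
  \<comment> \<open>Inserting the updates of \<open>gx\<close> and \<open>gu\<close> yields
    \<open>\<mu>\<^sub>1\<close> times this equation, which is the linear system for
    \<open>u\<close> rearranged.\<close>
  have u_stat: "transpose D *v gx (Suc k) + gu (Suc k) = b - u (Suc k)" for k
  proof -
    have "\<mu>\<^sub>1 *\<^sub>R (transpose D *v gx (Suc k) + gu (Suc k)) = \<mu>\<^sub>1 *\<^sub>R (b - u (Suc k))"
      using u_step[of k] assms(4,5)
      by (simp add: dual matrix_vector_right_distrib matrix_vector_mult_diff_distrib
          matrix_vector_mult_scaleR algebra_simps)
    then show ?thesis using assms(4) by simp
  qed
  have v_stat: "transpose D *v (P *v gy (Suc k)) + gv (Suc k) = 0" for k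
  proof -
    have "\<mu>\<^sub>1 *\<^sub>R (transpose D *v (P *v gy (Suc k)) + gv (Suc k)) = 0"
      using v_step[of k] assms(4,5)
      by (simp add: dual matrix_vector_right_distrib matrix_vector_mult_diff_distrib
          matrix_vector_mult_scaleR PPt algebra_simps)
    then show ?thesis using assms(4) by simp
  qed
  define X where "X k = (dx k, dy k, w k)" for k
  define Y where "Y k = (u k, v k)" for k
  define \<Gamma> where "\<Gamma> k = (?a *\<^sub>R gx k, ?a *\<^sub>R gy k, ?c *\<^sub>R gu k, ?c *\<^sub>R gv k)" for k
  let ?A = "tv_left P ?a ?c" and ?B = "tv_right D P ?a ?c"
  \<comment> \<open>Translates one component of the unit-penalty inner product back to penalty
    \<open>\<mu>\<close>, with \<open>s\<close> its square root.\<close>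
  have scaled: "(s *\<^sub>R g + (1 / s) *\<^sub>R y - (1 / s) *\<^sub>R x) \<bullet> ((1 / s) *\<^sub>R z) = (y + \<mu> *\<^sub>R g - x) \<bullet> z / \<mu>"
    if "s \<noteq> 0" "s * s = \<mu>" for s \<mu> and g x y z :: "real ^ 'm::{finite,linorder}"
    using that by (auto simp: inner_simps field_simps)
  have x_step: "tv_reg lam (X (Suc k)) + (\<Gamma> k + ?B (Y k) - ?A (X (Suc k))) \<bullet> ?A (x - X (Suc k))
      \<le> tv_reg lam x" for k x
  proof -
    obtain p q r where x: "x = (p, q, r)" by (metis prod.exhaust)
    let ?xi = "(D *v u k + \<mu>\<^sub>1 *\<^sub>R gx k - dx (Suc k)) \<bullet> (p - dx (Suc k))"
    let ?yi = "(transpose P *v (D *v v k) + \<mu>\<^sub>1 *\<^sub>R gy k - dy (Suc k)) \<bullet> (q - dy (Suc k))"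
    have "lam * \<mu>\<^sub>1 * (\<Sum>i\<in>UNIV. norm (dx (Suc k) $ i, dy (Suc k) $ i)) + ?xi + ?yi
        \<le> lam * \<mu>\<^sub>1 * (\<Sum>i\<in>UNIV. norm (p $ i, q $ i))"
      using assms(3,4) by (intro block_soft_threshold_prox prox) auto
    then have "\<mu>\<^sub>1 * tv_reg lam (X (Suc k)) + ?xi + ?yi \<le> \<mu>\<^sub>1 * tv_reg lam x"
      by (simp add: x X_def mult_ac)
    then have reg: "tv_reg lam (X (Suc k)) + ?xi / \<mu>\<^sub>1 + ?yi / \<mu>\<^sub>1 \<le> tv_reg lam x"
      using assms(4) by (simp add: field_simps)
    \<comment> \<open>\<open>tv_reg\<close> does not depend on \<open>w\<close>, so the last two
      components must contribute zero. Moving \<open>P\<close> to the other side and using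
      \<open>P^T P = I\<close> produces \<open>2 w\<close>, and the update of \<open>w\<close> makes
      the factor vanish.\<close>
    have "(u k + \<mu>\<^sub>2 *\<^sub>R gu k - w (Suc k)) \<bullet> (r - w (Suc k))
          + (v k + \<mu>\<^sub>2 *\<^sub>R gv k - P *v w (Suc k)) \<bullet> (P *v (r - w (Suc k)))
        = (u k + \<mu>\<^sub>2 *\<^sub>R gu k - w (Suc k) + transpose P *v (v k + \<mu>\<^sub>2 *\<^sub>R gv k - P *v w (Suc k)))
          \<bullet> (r - w (Suc k))"
      by (simp only: inner_transpose_mult inner_add_left)
    also have "u k + \<mu>\<^sub>2 *\<^sub>R gu k - w (Suc k) + transpose P *v (v k + \<mu>\<^sub>2 *\<^sub>R gv k - P *v w (Suc k))
        = (u k + transpose P *v v k + \<mu>\<^sub>2 *\<^sub>R (gu k + transpose P *v gv k)) - 2 *\<^sub>R w (Suc k)"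
      by (simp add: matrix_vector_right_distrib matrix_vector_mult_diff_distrib
          matrix_vector_mult_scaleR PtP algebra_simps scaleR_2)
    also have "\<dots> = 0" by (simp add: w_step)
    finally have "(u k + \<mu>\<^sub>2 *\<^sub>R gu k - w (Suc k)) \<bullet> (r - w (Suc k)) / \<mu>\<^sub>2
          + (v k + \<mu>\<^sub>2 *\<^sub>R gv k - P *v w (Suc k)) \<bullet> (P *v (r - w (Suc k))) / \<mu>\<^sub>2 = 0"
      by (simp add: add_divide_distrib[symmetric])
    then have "(\<Gamma> k + ?B (Y k) - ?A (X (Suc k))) \<bullet> ?A (x - X (Suc k)) = ?xi / \<mu>\<^sub>1 + ?yi / \<mu>\<^sub>1"
      using scaled[OF nz(1) sq(1)] scaled[OF nz(2) sq(2)]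
      by (simp only: x X_def Y_def \<Gamma>_def tv_left.simps tv_right.simps diff_Pair add_Pair
          inner_Pair)
    with reg show ?thesis by simp
  qed
  have y_step: "tv_fit b (Y (Suc k)) - \<Gamma> (Suc k) \<bullet> ?B (y - Y (Suc k)) \<le> tv_fit b y" for k y
    unfolding Y_def \<Gamma>_def by (intro tv_fit_stationary u_stat v_stat nz)
  have root: "s *\<^sub>R (g + (1 / \<mu>) *\<^sub>R z) = s *\<^sub>R g + (1 / s) *\<^sub>R z"
    if "s \<noteq> 0" "s * s = \<mu>" for s \<mu> and g z :: "real ^ 'm::{finite,linorder}"
    using that by (auto simp: scaleR_add_right)
  have dual_step: "\<Gamma> (Suc k) = \<Gamma> k + (?B (Y (Suc k)) - ?A (X (Suc k)))" for k
    unfolding \<Gamma>_def X_def Y_def dual root[OF nz(1) sq(1)] root[OF nz(2) sq(2)]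
    by (simp add: scaleR_diff_right)
  obtain x0 y0 \<gamma>0 where "kkt_point (tv_reg lam) (tv_fit b) ?A ?B x0 y0 \<gamma>0"
    using ex_kkt_point[OF less_imp_le[OF assms(3)] nz orth] .
  then obtain x y \<gamma> where K: "kkt_point (tv_reg lam) (tv_fit b) ?A ?B x y \<gamma>"
    and lim: "(\<lambda>k. X (Suc k)) \<longlonglongrightarrow> x" "(\<lambda>k. Y (Suc k)) \<longlonglongrightarrow> y" "(\<lambda>k. \<Gamma> (Suc k)) \<longlonglongrightarrow> \<gamma>"
    by (rule admm_converges[where A="?A" and B="?B" and f="tv_reg lam" and g="tv_fit b"
          and X=X and Y=Y and \<Gamma>=\<Gamma>, OF linear_tv_left inj_tv_left[OF nz] linear_tv_right
          inj_tv_right[OF nz(2)] continuous_on_tv_reg continuous_on_tv_fit x_step y_step dual_step])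
  obtain dx' dy' w' where x: "x = (dx', dy', w')" by (metis prod.exhaust)
  obtain u' v' where y: "y = (u', v')" by fastforce
  \<comment> \<open>The limit is a scaled multiplier; undoing the scaling gives the multipliers of
    the original problem.\<close>
  obtain gx' gy' gu' gv' where g: "\<gamma> = (?a *\<^sub>R gx', ?a *\<^sub>R gy', ?c *\<^sub>R gu', ?c *\<^sub>R gv')"
  proof -
    obtain g1 g2 g3 g4 where "\<gamma> = (g1, g2, g3, g4)" by (metis prod.exhaust)
    then show thesis
      using that[of "(1 / ?a) *\<^sub>R g1" "(1 / ?a) *\<^sub>R g2" "(1 / ?c) *\<^sub>R g3" "(1 / ?c) *\<^sub>R g4"] nz by simp
  qed
  have limX: "(\<lambda>k. dx (Suc k)) \<longlonglongrightarrow> dx'" "(\<lambda>k. dy (Suc k)) \<longlonglongrightarrow> dy'" "(\<lambda>k. w (Suc k)) \<longlonglongrightarrow> w'"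
    using tendsto_fst[OF lim(1)] tendsto_fst[OF tendsto_snd[OF lim(1)]]
      tendsto_snd[OF tendsto_snd[OF lim(1)]] by (simp_all add: X_def x)
  have limY: "(\<lambda>k. u (Suc k)) \<longlonglongrightarrow> u'" "(\<lambda>k. v (Suc k)) \<longlonglongrightarrow> v'"
    using tendsto_fst[OF lim(2)] tendsto_snd[OF lim(2)] by (simp_all add: Y_def y)
  have unscale: "h \<longlonglongrightarrow> h'" if "(\<lambda>k. s *\<^sub>R h k) \<longlonglongrightarrow> s *\<^sub>R h'" "s \<noteq> 0"
    for s :: real and h :: "nat \<Rightarrow> real ^ 'm::{finite,linorder}" and h'
    using tendsto_scaleR[OF tendsto_const[of "1 / s"] that(1)] that(2) by simp
  have "(\<lambda>k. ?a *\<^sub>R gx (Suc k)) \<longlonglongrightarrow> ?a *\<^sub>R gx'" "(\<lambda>k. ?a *\<^sub>R gy (Suc k)) \<longlonglongrightarrow> ?a *\<^sub>R gy'"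
    "(\<lambda>k. ?c *\<^sub>R gu (Suc k)) \<longlonglongrightarrow> ?c *\<^sub>R gu'" "(\<lambda>k. ?c *\<^sub>R gv (Suc k)) \<longlonglongrightarrow> ?c *\<^sub>R gv'"
    using tendsto_fst[OF lim(3)] tendsto_fst[OF tendsto_snd[OF lim(3)]]
      tendsto_fst[OF tendsto_snd[OF tendsto_snd[OF lim(3)]]]
      tendsto_snd[OF tendsto_snd[OF tendsto_snd[OF lim(3)]]]
    unfolding \<Gamma>_def g fst_conv snd_conv by simp_all
  note limG = this(1,2)[THEN unscale, OF nz(1)] this(3,4)[THEN unscale, OF nz(2)]
  have "tv_primal_dual_optimal D P lam b (dx', dy', w', u', v') (gx', gy', gu', gv')"
    using K nz unfolding x y g by (intro tv_primal_dual_optimal_if_kkt) auto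
  moreover have "(\<lambda>k. ((dx (Suc k), dy (Suc k), w (Suc k), u (Suc k), v (Suc k)),
            (gx (Suc k), gy (Suc k), gu (Suc k), gv (Suc k))))
      \<longlonglongrightarrow> ((dx', dy', w', u', v'), (gx', gy', gu', gv'))"
    by (intro tendsto_Pair limX limY limG)
  ultimately show ?thesis using ex1 by blast
qed

end
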